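(* Let $n\ge 2$. The inequality $P(|a\cdot\epsilon|\le\|a\|)\ge\frac12$ holds for all $a\in\mathbb{R}^n$ (Tomaszewski's conjecture in dimension $n$) if and only if each connected component of the set $$A=\{a\in\mathcal{S}^{n-1}: P(|a\cdot\epsilon|=1)=0\},$$ equipped with the topology inherited from $\mathcal{S}^{n-1}$, contains at least one point $a$ satisfying $$P(|a\cdot\epsilon|\le 1)\ge\frac12 .$$
   Context: $\epsilon=(\epsilon_1,\dots,\epsilon_n)$, where $\epsilon_1,\dots,\epsilon_n$ are independent random variables with $P(\epsilon_i=1)=P(\epsilon_i=-1)=\frac12$. For $a=(a_1,\dots,a_n)\in\mathbb{R}^n$, $a\cdot\epsilon=a_1\epsilon_1+\cdots+a_n\epsilon_n$ and $\|a\|=(\sum_{i=1}^n a_i^2)^{1/2}$. $\mathcal{S}^{n-1}=\{a\in\mathbb{R}^n:\|a\|=1\}$ with its usual topology. *)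

theory Defs
  imports "HOL-Probability.Probability"
begin

definition rademacher_family :: "'w measure \<Rightarrow> ('n \<Rightarrow> 'w \<Rightarrow> real) \<Rightarrow> bool" where
  "rademacher_family M \<epsilon> \<longleftrightarrow>
     prob_space M \<and>
     prob_space.indep_vars M (\<lambda>_. borel) \<epsilon> UNIV \<and>
     (\<forall>i. \<P>(\<omega> in M. \<epsilon> i \<omega> = 1) = 1/2 \<and> \<P>(\<omega> in M. \<epsilon> i \<omega> = -1) = 1/2)"

definition rademacher_sum :: "('n::finite \<Rightarrow> 'w \<Rightarrow> real) \<Rightarrow> real ^ 'n \<Rightarrow> 'w \<Rightarrow> real" where
  "rademacher_sum \<epsilon> a \<omega> = (\<Sum>i\<in>UNIV. a $ i * \<epsilon> i \<omega>)"

text \<open>The topology that the sphere induces on this set is the Euclidean subspace topology,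
  so its connected components are given by the library's \<open>components\<close>.\<close>

definition regular_directions ::
    "'w measure \<Rightarrow> ('n::finite \<Rightarrow> 'w \<Rightarrow> real) \<Rightarrow> (real ^ 'n) set" where
  "regular_directions M \<epsilon> =
     {a \<in> sphere 0 1. \<P>(\<omega> in M. \<bar>rademacher_sum \<epsilon> a \<omega>\<bar> = 1) = 0}"

end

theory Submission
  imports Defs
begin

text \<open>Almost surely \<open>\<epsilon>\<close> is one of the finitely many vectors \<open>s\<close> with entries \<open>\<plusminus>1\<close>, so
  everything depends on how \<open>\<bar>a \<bullet> s\<bar>\<close> compares with \<open>norm a\<close> for these finitely many \<open>s\<close>. Strict
  comparisons persist when \<open>a\<close> moves a little (\<open>strict_comparisons_persist\<close>). This has two
  consequences.

  On the regular directions no comparison is an equality, up to a null event, so the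
  probability is locally constant there and hence constant on each component; one good point
  makes the whole component good (\<open>prob_le_norm_constant_on_component\<close>).

  At an arbitrary \<open>a\<close> the strict inequalities \<open>\<bar>a \<bullet> s\<bar> > norm a\<close> persist, so nearby vectors have a
  probability that is no larger (\<open>eventually_prob_le_norm_le\<close>). In dimension at least 2, vectors
  for which no \<open>s\<close> gives equality exist arbitrarily close to \<open>a\<close>
  (\<open>eventually_no_equality_along_line\<close>); after normalization, which does not change the
  probability, such a vector is a regular direction. Its component is good, so \<open>a\<close> is good as
  well.

  Conversely, a bound valid for all vectors gives a good point in every component because regular
  directions have norm 1 and components are nonempty.\<close>

definition sign_vectors :: "(real ^ 'n::finite) set" where
  "sign_vectors = {s. \<forall>i. s $ i = 1 \<or> s $ i = -1}"

lemma finite_sign_vectors: "finite (sign_vectors :: (real ^ 'n::finite) set)"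
proof -
  have "s \<in> range (\<lambda>S. \<chi> i. if i \<in> S then 1 else -1)" if "s \<in> sign_vectors" for s :: "real ^ 'n"
    using that
    by (intro range_eqI[of _ _ "{i. s $ i = 1}"]) (auto simp: sign_vectors_def vec_eq_iff)
  then show ?thesis
    by (meson finite finite_imageI finite_subset subsetI)
qed

lemma sign_vectors_nonempty: "(\<chi> i. 1) \<in> sign_vectors"
  by (simp add: sign_vectors_def)

lemma eventually_less_if_limit_less:
  fixes f g :: "'a \<Rightarrow> real"
  assumes "(f \<longlongrightarrow> x) F" "(g \<longlongrightarrow> y) F"
  shows "\<forall>\<^sub>F b in F. x < y \<longrightarrow> f b < g b"
proof (cases "x < y")
  case True
  have "((\<lambda>b. g b - f b) \<longlongrightarrow> y - x) F"
    using assms by (intro tendsto_intros)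
  from order_tendstoD(1)[OF this, of 0] True show ?thesis
    by simp
qed simp

lemma strict_comparisons_persist:
  fixes a :: "real ^ 'n::finite"
  shows "\<forall>\<^sub>F b in nhds a. \<forall>s\<in>sign_vectors.
           (norm a < \<bar>a \<bullet> s\<bar> \<longrightarrow> norm b < \<bar>b \<bullet> s\<bar>) \<and> (\<bar>a \<bullet> s\<bar> < norm a \<longrightarrow> \<bar>b \<bullet> s\<bar> < norm b)"
proof (rule eventually_ball_finite[OF finite_sign_vectors], intro ballI eventually_conj)
  fix s :: "real ^ 'n"
  have norm_lim: "((\<lambda>b. norm b) \<longlongrightarrow> norm a) (nhds a)"
    and inner_lim: "((\<lambda>b. \<bar>b \<bullet> s\<bar>) \<longlongrightarrow> \<bar>a \<bullet> s\<bar>) (nhds a)"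
    by (intro tendsto_intros filterlim_ident)+
  show "\<forall>\<^sub>F b in nhds a. norm a < \<bar>a \<bullet> s\<bar> \<longrightarrow> norm b < \<bar>b \<bullet> s\<bar>"
    using eventually_less_if_limit_less[OF norm_lim inner_lim] by simp
  show "\<forall>\<^sub>F b in nhds a. \<bar>a \<bullet> s\<bar> < norm a \<longrightarrow> \<bar>b \<bullet> s\<bar> < norm b"
    using eventually_less_if_limit_less[OF inner_lim norm_lim] by simp
qed

text \<open>The direction \<open>2 e\<^sub>i + e\<^sub>j\<close> has squared norm 5, whereas its inner product with a sign vector
  is \<open>\<plusminus>1\<close> or \<open>\<plusminus>3\<close>, with square 1 or 9. Hence \<open>(b \<bullet> s)\<^sup>2 - (norm b)\<^sup>2\<close>, restricted to a line in
  this direction, is a quadratic polynomial with nonzero leading coefficient for every \<open>s\<close>.\<close>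

lemma eventually_no_equality_along_line:
  fixes a :: "real ^ 'n::finite"
  assumes "i \<noteq> j"
  defines "v \<equiv> 2 *\<^sub>R axis i 1 + axis j 1"
  shows "\<forall>\<^sub>F t in at (0::real). \<forall>s\<in>sign_vectors. \<bar>(a + t *\<^sub>R v) \<bullet> s\<bar> \<noteq> norm (a + t *\<^sub>R v)"
proof (rule eventually_ball_finite[OF finite_sign_vectors], intro ballI)
  fix s :: "real ^ 'n" assume s: "s \<in> sign_vectors"
  define p where "p = [:(a \<bullet> s)\<^sup>2 - a \<bullet> a, 2 * (a \<bullet> s) * (v \<bullet> s) - 2 * (a \<bullet> v), (v \<bullet> s)\<^sup>2 - v \<bullet> v:]"
  have "v \<bullet> v = 5"
    using assms(1) by (simp add: v_def inner_simps inner_axis_axis)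
  moreover have "v \<bullet> s = 2 * s $ i + s $ j"
    by (simp add: v_def inner_simps inner_axis')
  moreover have "s $ i \<in> {1, -1}" "s $ j \<in> {1, -1}"
    using s by (auto simp: sign_vectors_def)
  ultimately have "(v \<bullet> s)\<^sup>2 - v \<bullet> v \<noteq> 0"
    by auto
  then have "p \<noteq> 0"
    by (simp add: p_def)
  then have "finite {t. poly p t = 0}"
    by (rule poly_roots_finite)
  then have "\<forall>\<^sub>F t in at 0. \<forall>r\<in>{t. poly p t = 0}. t \<noteq> r"
    by (rule eventually_ball_finite) (simp add: eventually_neq_at_within)
  then show "\<forall>\<^sub>F t in at 0. \<bar>(a + t *\<^sub>R v) \<bullet> s\<bar> \<noteq> norm (a + t *\<^sub>R v)"
  proof eventually_elim
    case (elim t)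
    have "poly p t = ((a + t *\<^sub>R v) \<bullet> s)\<^sup>2 - (a + t *\<^sub>R v) \<bullet> (a + t *\<^sub>R v)"
      by (simp add: p_def inner_simps inner_commute power2_eq_square algebra_simps)
    also have "\<dots> = \<bar>(a + t *\<^sub>R v) \<bullet> s\<bar>\<^sup>2 - (norm (a + t *\<^sub>R v))\<^sup>2"
      by (simp add: power2_norm_eq_inner)
    finally show ?case
      using elim by (metis (mono_tags) mem_Collect_eq cancel_comm_monoid_add_class.diff_cancel)
  qed
qed

lemma rademacher_sum_eq_inner: "rademacher_sum \<epsilon> a \<omega> = a \<bullet> (\<chi> i. \<epsilon> i \<omega>)"
  by (simp add: rademacher_sum_def inner_vec_def)

lemma rademacher_sum_scaleR: "rademacher_sum \<epsilon> (c *\<^sub>R a) \<omega> = c * rademacher_sum \<epsilon> a \<omega>"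
  by (simp add: rademacher_sum_eq_inner)

context
  fixes M :: "'w measure" and \<epsilon> :: "'n::finite \<Rightarrow> 'w \<Rightarrow> real"
  assumes rademacher: "rademacher_family M \<epsilon>"
begin

interpretation prob_space M
  using rademacher by (simp add: rademacher_family_def)

lemma measurable_family: "\<epsilon> i \<in> borel_measurable M"
  using rademacher by (simp add: rademacher_family_def indep_vars_def2)

lemma measurable_rademacher_sum [measurable]: "rademacher_sum \<epsilon> a \<in> borel_measurable M"
  unfolding rademacher_sum_def[abs_def] using measurable_family by measurable

lemma AE_sign_vectors: "AE \<omega> in M. (\<chi> i. \<epsilon> i \<omega>) \<in> sign_vectors"
proof -
  have "AE \<omega> in M. \<epsilon> i \<omega> = 1 \<or> \<epsilon> i \<omega> = -1" for i
  proof -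
    note measurable_family[of i, measurable]
    have "\<P>(\<omega> in M. \<epsilon> i \<omega> = 1 \<or> \<epsilon> i \<omega> = -1) = \<P>(\<omega> in M. \<epsilon> i \<omega> = 1) + \<P>(\<omega> in M. \<epsilon> i \<omega> = -1)"
      by (subst finite_measure_Union[symmetric]) (auto intro!: arg_cong[where f = prob])
    also have "\<dots> = 1"
      using rademacher unfolding rademacher_family_def by (metis field_sum_of_halves)
    finally show ?thesis
      by (subst (asm) prob_Collect_eq_1) auto
  qed
  then show ?thesis
    by (simp add: sign_vectors_def AE_all_countable)
qed

text \<open>Upper semicontinuity of the probability at an arbitrary vector.\<close>

lemma eventually_prob_le_norm_le:
  "\<forall>\<^sub>F b in nhds a. \<P>(\<omega> in M. \<bar>rademacher_sum \<epsilon> b \<omega>\<bar> \<le> norm b) \<le>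
                   \<P>(\<omega> in M. \<bar>rademacher_sum \<epsilon> a \<omega>\<bar> \<le> norm a)"
  using strict_comparisons_persist[of a]
proof eventually_elim
  case (elim b)
  note persist = elim
  have "AE \<omega> in M. \<bar>rademacher_sum \<epsilon> b \<omega>\<bar> \<le> norm b \<longrightarrow> \<bar>rademacher_sum \<epsilon> a \<omega>\<bar> \<le> norm a"
    using AE_sign_vectors
  proof eventually_elim
    case (elim \<omega>)
    then show ?case
      using persist unfolding rademacher_sum_eq_inner by (meson not_le)
  qed
  then show ?case
    by (intro finite_measure_mono_AE) auto
qed

lemma regular_directions_norm: "a \<in> regular_directions M \<epsilon> \<Longrightarrow> norm a = 1"
  by (simp add: regular_directions_def)

lemma AE_neq_norm_if_regular:
  assumes "a \<in> regular_directions M \<epsilon>"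
  shows "AE \<omega> in M. \<bar>rademacher_sum \<epsilon> a \<omega>\<bar> \<noteq> norm a"
  using assms prob_Collect_eq_0[of "\<lambda>\<omega>. \<bar>rademacher_sum \<epsilon> a \<omega>\<bar> = 1"]
  by (simp add: regular_directions_def)

lemma regular_direction_if_no_equality:
  assumes "norm b = 1" and "\<And>s. s \<in> sign_vectors \<Longrightarrow> \<bar>b \<bullet> s\<bar> \<noteq> 1"
  shows "b \<in> regular_directions M \<epsilon>"
proof -
  have "AE \<omega> in M. \<bar>rademacher_sum \<epsilon> b \<omega>\<bar> \<noteq> 1"
    using AE_sign_vectors by eventually_elim (simp add: rademacher_sum_eq_inner assms(2))
  then have "\<P>(\<omega> in M. \<bar>rademacher_sum \<epsilon> b \<omega>\<bar> = 1) = 0"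
    by (subst prob_Collect_eq_0) auto
  then show ?thesis
    using assms(1) by (simp add: regular_directions_def)
qed

text \<open>At a regular direction the event of equality is null, so both strict comparisons together
  decide the event \<open>\<bar>a \<bullet> \<epsilon>\<bar> \<le> norm a\<close> almost surely and nearby vectors have the same
  probability.\<close>

lemma prob_le_norm_constant_on_component:
  assumes C: "C \<in> components (regular_directions M \<epsilon>)" and "a \<in> C" "b \<in> C"
  shows "\<P>(\<omega> in M. \<bar>rademacher_sum \<epsilon> a \<omega>\<bar> \<le> norm a) = \<P>(\<omega> in M. \<bar>rademacher_sum \<epsilon> b \<omega>\<bar> \<le> norm b)"
    (is "?f a = ?f b")
proof (rule connected_local_const[of C, where f = ?f])
  show "\<forall>a\<in>C. \<forall>\<^sub>F b in at a within C. ?f a = ?f b"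
  proof
    fix a assume "a \<in> C"
    then have "a \<in> regular_directions M \<epsilon>"
      using C in_components_subset by blast
    then have neq: "AE \<omega> in M. \<bar>rademacher_sum \<epsilon> a \<omega>\<bar> \<noteq> norm a"
      by (rule AE_neq_norm_if_regular)
    have "\<forall>\<^sub>F b in nhds a. ?f a = ?f b"
      using strict_comparisons_persist[of a]
    proof eventually_elim
      case (elim b)
      note persist = elim
      have "AE \<omega> in M. \<bar>rademacher_sum \<epsilon> a \<omega>\<bar> \<le> norm a \<longleftrightarrow> \<bar>rademacher_sum \<epsilon> b \<omega>\<bar> \<le> norm b"
        using AE_sign_vectors neq
      proof eventually_elim
        case (elim \<omega>)
        then show ?case
          using persist unfolding rademacher_sum_eq_inner
          by (meson linorder_neq_iff not_le less_imp_le)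
      qed
      then show ?case
        by (intro finite_measure_eq_AE) auto
    qed
    then show "\<forall>\<^sub>F b in at a within C. ?f a = ?f b"
      using at_within_le_nhds filter_leD by blast
  qed
qed (use assms in_components_connected in auto)

lemma prob_le_norm_scaleR:
  assumes "c > 0"
  shows "\<P>(\<omega> in M. \<bar>rademacher_sum \<epsilon> (c *\<^sub>R a) \<omega>\<bar> \<le> norm (c *\<^sub>R a)) =
         \<P>(\<omega> in M. \<bar>rademacher_sum \<epsilon> a \<omega>\<bar> \<le> norm a)"
  using assms by (simp add: rademacher_sum_scaleR abs_mult)

text \<open>Consequently every lower bound that holds on the regular directions holds for all vectors.\<close>

lemma regular_direction_with_smaller_prob:
  fixes a :: "real ^ 'n"
  assumes "CARD('n) \<ge> 2"
  obtains b where "b \<in> regular_directions M \<epsilon>"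
    and "\<P>(\<omega> in M. \<bar>rademacher_sum \<epsilon> b \<omega>\<bar> \<le> norm b) \<le> \<P>(\<omega> in M. \<bar>rademacher_sum \<epsilon> a \<omega>\<bar> \<le> norm a)"
proof -
  obtain i j :: 'n where "i \<noteq> j"
    using assms by (meson card_2_iff' ex_card UNIV_I subset_UNIV)
  define v :: "real ^ 'n" where "v = 2 *\<^sub>R axis i 1 + axis j 1"
  have "((\<lambda>t. a + t *\<^sub>R v) \<longlongrightarrow> a + 0 *\<^sub>R v) (at (0::real))"
    by (intro tendsto_intros)
  then have lim: "filterlim (\<lambda>t. a + t *\<^sub>R v) (nhds a) (at (0::real))"
    by simp
  have "\<forall>\<^sub>F t in at (0::real).
      \<P>(\<omega> in M. \<bar>rademacher_sum \<epsilon> (a + t *\<^sub>R v) \<omega>\<bar> \<le> norm (a + t *\<^sub>R v)) \<le>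
        \<P>(\<omega> in M. \<bar>rademacher_sum \<epsilon> a \<omega>\<bar> \<le> norm a) \<and>
      (\<forall>s\<in>sign_vectors. \<bar>(a + t *\<^sub>R v) \<bullet> s\<bar> \<noteq> norm (a + t *\<^sub>R v))"
    using eventually_compose_filterlim[OF eventually_prob_le_norm_le lim]
      eventually_no_equality_along_line[OF \<open>i \<noteq> j\<close>, of a]
    unfolding v_def by (rule eventually_conj)
  then obtain t :: real where
    small: "\<P>(\<omega> in M. \<bar>rademacher_sum \<epsilon> (a + t *\<^sub>R v) \<omega>\<bar> \<le> norm (a + t *\<^sub>R v)) \<le>
              \<P>(\<omega> in M. \<bar>rademacher_sum \<epsilon> a \<omega>\<bar> \<le> norm a)" and
    neq: "\<And>s. s \<in> sign_vectors \<Longrightarrow> \<bar>(a + t *\<^sub>R v) \<bullet> s\<bar> \<noteq> norm (a + t *\<^sub>R v)"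
    using eventually_happens'[OF at_neq_bot] by blast
  define b where "b = a + t *\<^sub>R v"
  \<comment> \<open>The zero vector has equality for every sign vector.\<close>
  have "b \<noteq> 0"
    using neq[OF sign_vectors_nonempty] by (auto simp: b_def)
  show thesis
  proof
    show "(1 / norm b) *\<^sub>R b \<in> regular_directions M \<epsilon>"
    proof (rule regular_direction_if_no_equality)
      fix s :: "real ^ 'n" assume "s \<in> sign_vectors"
      then have "\<bar>b \<bullet> s\<bar> \<noteq> norm b"
        using neq by (simp add: b_def)
      then show "\<bar>((1 / norm b) *\<^sub>R b) \<bullet> s\<bar> \<noteq> 1"
        using \<open>b \<noteq> 0\<close> by simp
    qed (use \<open>b \<noteq> 0\<close> in simp)
    show "\<P>(\<omega> in M. \<bar>rademacher_sum \<epsilon> ((1 / norm b) *\<^sub>R b) \<omega>\<bar> \<le> norm ((1 / norm b) *\<^sub>R b)) \<le>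
          \<P>(\<omega> in M. \<bar>rademacher_sum \<epsilon> a \<omega>\<bar> \<le> norm a)"
      using small \<open>b \<noteq> 0\<close> by (subst prob_le_norm_scaleR) (auto simp: b_def)
  qed
qed

end

theorem theorem2p3:
  fixes M :: "'w measure" and \<epsilon> :: "'n::finite \<Rightarrow> 'w \<Rightarrow> real"
  assumes "CARD('n) \<ge> 2"
    and "rademacher_family M \<epsilon>"
  shows "(\<forall>a :: real ^ 'n. \<P>(\<omega> in M. \<bar>rademacher_sum \<epsilon> a \<omega>\<bar> \<le> norm a) \<ge> 1/2) \<longleftrightarrow>
         (\<forall>C \<in> components (regular_directions M \<epsilon>).
            \<exists>a \<in> C. \<P>(\<omega> in M. \<bar>rademacher_sum \<epsilon> a \<omega>\<bar> \<le> 1) \<ge> 1/2)"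
    (is "?all \<longleftrightarrow> ?comp")
proof
  assume all: ?all
  show ?comp
  proof
    fix C assume C: "C \<in> components (regular_directions M \<epsilon>)"
    then obtain a where "a \<in> C"
      using in_components_nonempty by blast
    moreover from this have "norm a = 1"
      using C in_components_subset regular_directions_norm[OF assms(2)] by blast
    ultimately show "\<exists>a\<in>C. \<P>(\<omega> in M. \<bar>rademacher_sum \<epsilon> a \<omega>\<bar> \<le> 1) \<ge> 1/2"
      using all by metis
  qed
next
  assume comp: ?comp
  show ?all
  proof
    fix a :: "real ^ 'n"
    obtain b where b: "b \<in> regular_directions M \<epsilon>"
      and le: "\<P>(\<omega> in M. \<bar>rademacher_sum \<epsilon> b \<omega>\<bar> \<le> norm b) \<le> \<P>(\<omega> in M. \<bar>rademacher_sum \<epsilon> a \<omega>\<bar> \<le> norm a)"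
      using regular_direction_with_smaller_prob[OF assms(2,1)] by blast
    obtain C where C: "C \<in> components (regular_directions M \<epsilon>)" "b \<in> C"
      using b Union_components by blast
    then obtain c where c: "c \<in> C" "\<P>(\<omega> in M. \<bar>rademacher_sum \<epsilon> c \<omega>\<bar> \<le> 1) \<ge> 1/2"
      using comp by blast
    have "norm c = 1"
      using c C in_components_subset regular_directions_norm[OF assms(2)] by blast
    then show "\<P>(\<omega> in M. \<bar>rademacher_sum \<epsilon> a \<omega>\<bar> \<le> norm a) \<ge> 1/2"
      using prob_le_norm_constant_on_component[OF assms(2) C(1) c(1) C(2)] c(2) le by simp
  qed
qed

end
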